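(* Let $g\ge1$. Any element of $Sp_1$ is a product of elements of the following types: (1) elements of the subgroup $Sp(\mathbb{Z}_2,2)\times Sp_0(\mathbb{Z}_2,2g-2)$; (2) (if $g\ge2$) the matrix $B_2=\begin{pmatrix}A_2&0\\0&I_{2g-4}\end{pmatrix}$ with $$A_2=\begin{pmatrix}1&0&0&0\\0&1&0&1\\1&0&1&1\\0&0&0&1\end{pmatrix}.$$
   Context: $\mathbb{Z}_2^{2g}$ carries the standard symplectic form "$.$" with canonical basis $e_1,\dots,e_{2g}$ satisfying $e_{2i-1}.e_{2i}=e_{2i}.e_{2i-1}=1$ and all other products $0$. $Sp(\mathbb{Z}_2,2g)$ is its group of symplectic automorphisms (identified with matrices acting on column vectors). $\omega_0(x)=\sum_{k=1}^g x_{2k-1}x_{2k}$ and $\omega_1(x)=\omega_0(x)+x_1+x_2$. $Sp_1$ is the subgroup of those $f\in Sp(\mathbb{Z}_2,2g)$ with $\omega_1\circ f=\omega_1$. $Sp_0(\mathbb{Z}_2,2g-2)$ is the subgroup of the symplectic automorphisms of $\mathrm{Vect}(e_3,\dots,e_{2g})$ fixing the quadratic form $\sum_{k=2}^g x_{2k-1}x_{2k}$, and $Sp(\mathbb{Z}_2,2)\times Sp_0(\mathbb{Z}_2,2g-2)$ is embedded in $Sp(\mathbb{Z}_2,2g)$ block-diagonally, with $Sp(\mathbb{Z}_2,2)$ acting on $\mathrm{Vect}(e_1,e_2)$ (for $g=1$ the second factor is trivial). *)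

theory Defs
  imports "HOL-Library.Z2" "Jordan_Normal_Form.Matrix"
begin

(* Z_2 is the field type bit, and Z_2^(2g) is carrier_vec (2 * g) :: bit vec set.
   Coordinates start at 0, so that x_j (j = 1..2g) is x $ (j - 1);
   the hyperbolic pair (e_{2k-1}, e_{2k}), k = 1..g, sits at positions (2k, 2k + 1), k = 0..g-1.
   Automorphisms are identified with their matrices in the canonical basis, acting on
   column vectors by *\<^sub>v. *)

definition sympl_form :: "nat \<Rightarrow> bit vec \<Rightarrow> bit vec \<Rightarrow> bit" where
  "sympl_form g x y =
     (\<Sum>k<g. x $ (2 * k) * y $ (2 * k + 1) + x $ (2 * k + 1) * y $ (2 * k))"

lemma sympl_form_unit_vec:
  assumes "i < 2 * g" and "j < 2 * g"
  shows "sympl_form g (unit_vec (2 * g) i) (unit_vec (2 * g) j) =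
         (if i div 2 = j div 2 \<and> i \<noteq> j then 1 else 0)"
proof -
  let ?t = "\<lambda>k. unit_vec (2 * g) i $ (2 * k) * unit_vec (2 * g) j $ (2 * k + 1)
              + unit_vec (2 * g) i $ (2 * k + 1) * unit_vec (2 * g) j $ (2 * k) :: bit"
  have "?t k = (if k = i div 2 \<and> k = j div 2 \<and> i \<noteq> j then 1 else 0)" if "k < g" for k
    using that assms by (auto simp: unit_vec_def)
  then have "sympl_form g (unit_vec (2 * g) i) (unit_vec (2 * g) j) =
      (\<Sum>k<g. if k = i div 2 then (if i div 2 = j div 2 \<and> i \<noteq> j then 1 else 0) else 0)"
    unfolding sympl_form_def by (intro sum.cong) auto
  also have "\<dots> = (if i div 2 = j div 2 \<and> i \<noteq> j then 1 else 0)"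
    using assms by (subst sum.delta) auto
  finally show ?thesis .
qed

definition omega0 :: "nat \<Rightarrow> bit vec \<Rightarrow> bit" where
  "omega0 g x = (\<Sum>k<g. x $ (2 * k) * x $ (2 * k + 1))"

definition omega1 :: "nat \<Rightarrow> bit vec \<Rightarrow> bit" where
  "omega1 g x = omega0 g x + x $ 0 + x $ 1"

definition Sp :: "nat \<Rightarrow> bit mat set" where
  "Sp g = {A \<in> carrier_mat (2 * g) (2 * g). invertible_mat A \<and>
     (\<forall>x \<in> carrier_vec (2 * g). \<forall>y \<in> carrier_vec (2 * g).
        sympl_form g (A *\<^sub>v x) (A *\<^sub>v y) = sympl_form g x y)}"

definition Sp0 :: "nat \<Rightarrow> bit mat set" where
  "Sp0 g = {A \<in> Sp g. \<forall>x \<in> carrier_vec (2 * g). omega0 g (A *\<^sub>v x) = omega0 g x}"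

definition Sp1 :: "nat \<Rightarrow> bit mat set" where
  "Sp1 g = {A \<in> Sp g. \<forall>x \<in> carrier_vec (2 * g). omega1 g (A *\<^sub>v x) = omega1 g x}"

(* Block-diagonal copy of Sp(Z_2, 2) x Sp_0(Z_2, 2g-2).  Vect(e_3, ..., e_{2g}) with its
   form and the quadratic form sum_{k=2}^g x_{2k-1} x_{2k} is identified, by shifting
   coordinates by 2, with Z_2^(2(g-1)) carrying sympl_form (g - 1) and omega0 (g - 1).
   For g = 1 the second factor consists of the 0 x 0 matrix only. *)
definition Sp_block :: "nat \<Rightarrow> bit mat set" where
  "Sp_block g =
     {four_block_mat A (0\<^sub>m 2 (2 * (g - 1))) (0\<^sub>m (2 * (g - 1)) 2) D | A D.
        A \<in> Sp 1 \<and> D \<in> Sp0 (g - 1)}"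

definition A2 :: "bit mat" where
  "A2 = mat_of_rows_list 4
     [[1, 0, 0, 0],
      [0, 1, 0, 1],
      [1, 0, 1, 1],
      [0, 0, 0, 1]]"

(* Meaningful for g >= 2 only. *)
definition B2 :: "nat \<Rightarrow> bit mat" where
  "B2 g = four_block_mat A2 (0\<^sub>m 4 (2 * g - 4)) (0\<^sub>m (2 * g - 4) 4) (1\<^sub>m (2 * g - 4))"

end

theory Submission
  imports Defs "Jordan_Normal_Form.Determinant"
begin

text \<open>
  Write $q$ for \<^const>\<open>omega1\<close>, whose polar form is the symplectic form, and call a vector
  $a$ nonsingular if $q(a) = 1$. The transvection $t_a(x) = x + (x.a) a$ is an involution that
  preserves the form, and it preserves $q$ exactly when $a$ is nonsingular (or zero). Let $P$ be the plane
  spanned by the first hyperbolic pair and $W$ its orthogonal complement. Transvections along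
  nonsingular vectors of $P$ or of $W$ are block-diagonal, and in the informal numbering
  $B_2 = t_{e_2 + e_3} t_{e_2}$, so multiplying by $t_{e_2+e_3}$ is the same as multiplying by $B_2$
  and a block-diagonal involution. All factors can therefore be taken to be transvections, except
  for one last block-diagonal matrix.

  Given $f$, such transvections move $f(e_1)$ to $e_1$ (lemma \<open>nonsingular_to_e0\<close>) and then
  $f(e_2)$ to $e_2$ while fixing $e_1$ (lemma \<open>nonsingular_to_e1_fixing_e0\<close>). The resulting element
  of \<^const>\<open>Sp1\<close> fixes $P$ pointwise, hence preserves $W$, and so is block-diagonal
  (lemma \<open>fixes_plane_imp_Sp_block\<close>). Because transvections are involutions, they can be
  carried back to the other side of the equation.

  The two moves follow one pattern. Split a nonsingular vector as $p + w$ with $p \<in> P$ and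
  $w \<in> W$. Since $q$ is 1 on every nonzero vector of $P$, either $p = 0$ or $w$ is singular.
  A nonzero singular $w$ can be moved to $e_3$ by transvections along $W$ (lemma
  \<open>singular_to_e2\<close>), after which $t_{e_2+e_3}$ or a conjugate of it absorbs $e_3$ into $P$.
  If $p = 0$, transvections along $W$ first make $w.e_3 = 1$, and then $t_{e_2+e_3}$ gives the
  vector a nonzero component in $P$.

  Coordinates in the formal text start at 0, so that \<open>e g j\<close> stands for $e_{j+1}$.
\<close>

section \<open>The symplectic form and its quadratic forms\<close>

text \<open>
  The index of the other member of the hyperbolic pair containing a given basis vector.
\<close>

definition partner :: "nat \<Rightarrow> nat" where
  "partner j = (if even j then j + 1 else j - 1)"

lemma partner_less: "j < 2 * g \<Longrightarrow> partner j < 2 * g"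
  by (auto simp: partner_def elim!: evenE)

lemma bit_char_two_simps [simp]: "(x::bit) + x = 0" "(x::bit) + (x + y) = y" "(x::bit) * x = x"
  by (cases x; cases y; simp)+

text \<open>
  The default rewriting of sums and products in \<^typ>\<open>bit\<close> to bitwise operations would
  block the ring laws of the field with two elements.
\<close>

declare add_bit_eq_xor [simp del] mult_bit_eq_and [simp del]

lemma sum_pairs: "(\<Sum>j<2 * g. h j) = (\<Sum>k<g. h (2 * k) + h (2 * k + 1))" for h :: "nat \<Rightarrow> bit"
  by (induction g) (auto simp: algebra_simps)

lemma sympl_form_eq_sum_partner: "sympl_form g x y = (\<Sum>j<2 * g. x $ j * y $ partner j)"
  unfolding sum_pairs sympl_form_def by (simp add: partner_def)

lemma sympl_form_commute: "sympl_form g x y = sympl_form g y x"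
  by (simp add: sympl_form_def algebra_simps)

lemma sympl_form_self: "sympl_form g x x = 0"
  by (simp add: sympl_form_def mult.commute)

lemma sympl_form_add_left:
  "\<lbrakk>x \<in> carrier_vec (2 * g); y \<in> carrier_vec (2 * g)\<rbrakk> \<Longrightarrow>
     sympl_form g (x + y) z = sympl_form g x z + sympl_form g y z"
  unfolding sympl_form_eq_sum_partner sum.distrib[symmetric]
  by (intro sum.cong) (auto simp: algebra_simps)

lemma sympl_form_smult_left:
  "x \<in> carrier_vec (2 * g) \<Longrightarrow> sympl_form g (c \<cdot>\<^sub>v x) z = c * sympl_form g x z"
  unfolding sympl_form_eq_sum_partner sum_distrib_left
  by (intro sum.cong) (auto simp: algebra_simps)

lemma sympl_form_add_right:
  "\<lbrakk>x \<in> carrier_vec (2 * g); y \<in> carrier_vec (2 * g)\<rbrakk> \<Longrightarrow>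
     sympl_form g z (x + y) = sympl_form g z x + sympl_form g z y"
  using sympl_form_add_left sympl_form_commute by metis

lemma sympl_form_smult_right:
  "x \<in> carrier_vec (2 * g) \<Longrightarrow> sympl_form g z (c \<cdot>\<^sub>v x) = c * sympl_form g z x"
  using sympl_form_smult_left sympl_form_commute by metis

lemma sympl_form_unit_left:
  "j < 2 * g \<Longrightarrow> sympl_form g (unit_vec (2 * g) j) x = x $ partner j"
  unfolding sympl_form_eq_sum_partner
  by (subst sum.mono_neutral_cong_right[where S = "{j}" and h = "\<lambda>i. x $ partner i"]) auto

lemma omega0_add:
  assumes "x \<in> carrier_vec (2 * g)" "y \<in> carrier_vec (2 * g)"
  shows "omega0 g (x + y) = omega0 g x + omega0 g y + sympl_form g x y"
  unfolding omega0_def sympl_form_def sum.distrib[symmetric]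
  using assms by (intro sum.cong) (auto simp: algebra_simps)

lemma omega0_smult:
  "x \<in> carrier_vec (2 * g) \<Longrightarrow> omega0 g (c \<cdot>\<^sub>v x) = c * omega0 g x"
  unfolding omega0_def sum_distrib_left
  by (intro sum.cong) (cases c; auto)+

lemma omega1_add:
  assumes "x \<in> carrier_vec (2 * g)" "y \<in> carrier_vec (2 * g)" "g \<ge> 1"
  shows "omega1 g (x + y) = omega1 g x + omega1 g y + sympl_form g x y"
  using assms by (simp add: omega1_def omega0_add algebra_simps)

lemma omega1_smult:
  "\<lbrakk>x \<in> carrier_vec (2 * g); g \<ge> 1\<rbrakk> \<Longrightarrow> omega1 g (c \<cdot>\<^sub>v x) = c * omega1 g x"
  by (simp add: omega1_def omega0_smult algebra_simps)

section \<open>Transvections\<close>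

definition transvection :: "nat \<Rightarrow> bit vec \<Rightarrow> bit vec \<Rightarrow> bit vec" where
  "transvection g a x = x + sympl_form g x a \<cdot>\<^sub>v a"

lemma transvection_carrier [simp]:
  "\<lbrakk>a \<in> carrier_vec (2 * g); x \<in> carrier_vec (2 * g)\<rbrakk> \<Longrightarrow> transvection g a x \<in> carrier_vec (2 * g)"
  by (simp add: transvection_def)

lemma sympl_form_transvection:
  assumes "a \<in> carrier_vec (2 * g)" "x \<in> carrier_vec (2 * g)" "y \<in> carrier_vec (2 * g)"
  shows "sympl_form g (transvection g a x) (transvection g a y) = sympl_form g x y"
  using assms
  by (simp add: transvection_def sympl_form_add_left sympl_form_add_right sympl_form_smult_left
      sympl_form_smult_right sympl_form_self sympl_form_commute[of g a y] mult.commute)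

lemma transvection_involution:
  assumes "a \<in> carrier_vec (2 * g)" "x \<in> carrier_vec (2 * g)"
  shows "transvection g a (transvection g a x) = x"
proof (rule eq_vecI)
  fix i assume "i < dim_vec x"
  then show "transvection g a (transvection g a x) $ i = x $ i"
    using assms
    by (simp add: transvection_def sympl_form_add_left sympl_form_smult_left sympl_form_self add.assoc)
qed (use assms in \<open>simp add: transvection_def\<close>)

lemma omega0_transvection:
  assumes "a \<in> carrier_vec (2 * g)" "x \<in> carrier_vec (2 * g)" "omega0 g a = 1"
  shows "omega0 g (transvection g a x) = omega0 g x"
  using assms
  by (simp add: transvection_def omega0_add omega0_smult sympl_form_smult_right add.assoc)

lemma omega1_transvection:
  assumes "a \<in> carrier_vec (2 * g)" "x \<in> carrier_vec (2 * g)" "omega1 g a = 1" "g \<ge> 1"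
  shows "omega1 g (transvection g a x) = omega1 g x"
  using assms
  by (simp add: transvection_def omega1_add omega1_smult sympl_form_smult_right add.assoc)

text \<open>
  The coefficient of $x_j$ in $(x.a)$ is the coordinate of $a$ at the partner of $j$.
\<close>

definition transvection_mat :: "nat \<Rightarrow> bit vec \<Rightarrow> bit mat" where
  "transvection_mat g a =
     mat (2 * g) (2 * g) (\<lambda>(i, j). (if i = j then 1 else 0) + a $ i * a $ partner j)"

lemma transvection_mat_carrier [simp]: "transvection_mat g a \<in> carrier_mat (2 * g) (2 * g)"
  by (simp add: transvection_mat_def)

lemma transvection_mat_mult_vec:
  assumes "a \<in> carrier_vec (2 * g)" "x \<in> carrier_vec (2 * g)"
  shows "transvection_mat g a *\<^sub>v x = transvection g a x"
proof (rule eq_vecI)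
  fix i assume "i < dim_vec (transvection g a x)"
  then have i: "i < 2 * g" using assms by (simp add: transvection_def)
  have "(transvection_mat g a *\<^sub>v x) $ i =
      (\<Sum>j<2 * g. (if i = j then x $ j else 0) + x $ j * a $ partner j * a $ i)"
    using i assms by (auto simp: transvection_mat_def scalar_prod_def algebra_simps atLeast0LessThan intro!: sum.cong)
  also have "\<dots> = x $ i + sympl_form g x a * a $ i"
    using i by (simp add: sum.distrib sympl_form_eq_sum_partner sum_distrib_right)
  finally show "(transvection_mat g a *\<^sub>v x) $ i = transvection g a x $ i"
    using i assms by (simp add: transvection_def)
qed (use assms in \<open>simp add: transvection_def transvection_mat_def\<close>)

lemma mat_eq_if_mult_vec_eq:
  assumes A: "A \<in> carrier_mat m n" and B: "B \<in> carrier_mat m n"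
    and eq: "\<And>x. x \<in> carrier_vec n \<Longrightarrow> A *\<^sub>v x = B *\<^sub>v (x :: 'a :: comm_semiring_1 vec)"
  shows "A = B"
proof (rule eq_matI)
  fix i j assume "i < dim_row B" "j < dim_col B"
  then have ij: "i < m" "j < n" using B by auto
  have "(A *\<^sub>v unit_vec n j) $ i = (B *\<^sub>v unit_vec n j) $ i" using eq[of "unit_vec n j"] by simp
  then show "A $$ (i, j) = B $$ (i, j)" using A B ij by (simp add: row_def)
qed (use A B in auto)

lemma transvection_mat_involution:
  assumes "a \<in> carrier_vec (2 * g)"
  shows "transvection_mat g a * transvection_mat g a = 1\<^sub>m (2 * g)"
  using assms
  by (intro mat_eq_if_mult_vec_eq[of _ "2 * g" "2 * g"])
    (auto simp: assoc_mult_mat_vec[of _ "2 * g" "2 * g" _ "2 * g"] transvection_mat_mult_vec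
      transvection_involution intro!: mult_carrier_mat[of _ _ "2 * g"])

text \<open>
  Over a field, a one-sided inverse of a square matrix is two-sided.
\<close>

lemma invertible_mat_iff_right_inverse:
  assumes "A \<in> carrier_mat n n"
  shows "invertible_mat (A :: 'a :: field mat) \<longleftrightarrow> (\<exists>B \<in> carrier_mat n n. A * B = 1\<^sub>m n)"
proof
  assume "invertible_mat A"
  then obtain B where B: "A * B = 1\<^sub>m n" "B * A = 1\<^sub>m (dim_row B)"
    using assms by (auto simp: invertible_mat_def inverts_mat_def)
  have "dim_col (A * B) = n" "dim_col (B * A) = dim_row B" by (simp_all only: B index_one_mat)
  then have "B \<in> carrier_mat n n" using assms by (intro carrier_matI) auto
  with B show "\<exists>B \<in> carrier_mat n n. A * B = 1\<^sub>m n" by blast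
next
  assume "\<exists>B \<in> carrier_mat n n. A * B = 1\<^sub>m n"
  then obtain B where "B \<in> carrier_mat n n" "A * B = 1\<^sub>m n" by blast
  with mat_mult_left_right_inverse[OF assms] assms show "invertible_mat A"
    by (auto simp: invertible_mat_def inverts_mat_def)
qed

lemma transvection_mat_in_Sp:
  assumes "a \<in> carrier_vec (2 * g)" shows "transvection_mat g a \<in> Sp g"
proof -
  have "invertible_mat (transvection_mat g a)"
    using transvection_mat_involution[OF assms] transvection_mat_carrier
    by (subst invertible_mat_iff_right_inverse) blast+
  with assms show ?thesis
    by (simp add: Sp_def transvection_mat_mult_vec sympl_form_transvection)
qed

lemma transvection_mat_mult_in_Sp1:
  assumes a: "a \<in> carrier_vec (2 * g)" "omega1 g a = 1" and g: "g \<ge> 1" and f: "f \<in> Sp1 g"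
  shows "transvection_mat g a * f \<in> Sp1 g"
proof -
  let ?n = "2 * g" and ?T = "transvection_mat g a"
  have T: "?T \<in> carrier_mat ?n ?n" by simp
  have fc: "f \<in> carrier_mat ?n ?n" "invertible_mat f" using f by (auto simp: Sp1_def Sp_def)
  then obtain h where h: "h \<in> carrier_mat ?n ?n" "f * h = 1\<^sub>m ?n"
    using invertible_mat_iff_right_inverse by blast
  have "(?T * f) * (h * ?T) = ?T * ((f * h) * ?T)"
    using T fc h(1) by (simp add: assoc_mult_mat[of _ ?n ?n _ ?n _ ?n] mult_carrier_mat[of _ _ ?n])
  also have "\<dots> = 1\<^sub>m ?n" using h left_mult_one_mat[OF T] a by (simp add: transvection_mat_involution)
  finally have inv: "invertible_mat (?T * f)"
    using h(1) T fc by (subst invertible_mat_iff_right_inverse[of _ ?n])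
      (auto intro!: bexI[of _ "h * ?T"] mult_carrier_mat[of _ _ ?n])
  have fx: "f *\<^sub>v x \<in> carrier_vec ?n" if "x \<in> carrier_vec ?n" for x
    using fc that by simp
  have mult: "(?T * f) *\<^sub>v x = transvection g a (f *\<^sub>v x)" if "x \<in> carrier_vec ?n" for x
    using that a fx T fc by (simp add: assoc_mult_mat_vec[of _ ?n ?n _ ?n] transvection_mat_mult_vec)
  show ?thesis
    using f a g inv fx mult_carrier_mat[OF T fc(1)]
    by (simp add: Sp1_def Sp_def mult sympl_form_transvection omega1_transvection)
qed

lemma mult_unit_vec_index:
  "\<lbrakk>A \<in> carrier_mat m n; i < m; j < n\<rbrakk> \<Longrightarrow> (A *\<^sub>v unit_vec n j) $ i = A $$ (i, j)"
  for A :: "'a :: semiring_1 mat"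
  by (simp add: row_def)

section \<open>The block-diagonal subgroup\<close>

definition tail_vec :: "nat \<Rightarrow> bit vec \<Rightarrow> bit vec" where
  "tail_vec g x = vec (2 * (g - 1)) (\<lambda>i. x $ (i + 2))"

lemma tail_vec_carrier [simp]: "tail_vec g x \<in> carrier_vec (2 * (g - Suc 0))"
  by (simp add: tail_vec_def)

lemma sympl_form_split:
  assumes "g \<ge> 1"
  shows "sympl_form g x y = x $ 0 * y $ 1 + x $ 1 * y $ 0 + sympl_form (g - 1) (tail_vec g x) (tail_vec g y)"
proof -
  from assms obtain h where "g = Suc h" by (cases g) auto
  then show ?thesis
    unfolding sympl_form_def by (subst \<open>g = Suc h\<close>, subst sum.lessThan_Suc_shift) (simp add: tail_vec_def)
qed

lemma omega1_split:
  assumes "g \<ge> 1"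
  shows "omega1 g x = x $ 0 * x $ 1 + x $ 0 + x $ 1 + omega0 (g - 1) (tail_vec g x)"
proof -
  from assms obtain h where "g = Suc h" by (cases g) auto
  then show ?thesis
    unfolding omega0_def omega1_def
    by (subst \<open>g = Suc h\<close>, subst sum.lessThan_Suc_shift) (simp add: tail_vec_def algebra_simps)
qed

definition plane :: "nat \<Rightarrow> bit vec set" where
  "plane g = {x \<in> carrier_vec (2 * g). \<forall>i. 2 \<le> i \<and> i < 2 * g \<longrightarrow> x $ i = 0}"

definition plane_perp :: "nat \<Rightarrow> bit vec set" where
  "plane_perp g = {x \<in> carrier_vec (2 * g). x $ 0 = 0 \<and> x $ 1 = 0}"

lemma transvection_zero: "x \<in> carrier_vec (2 * g) \<Longrightarrow> transvection g (0\<^sub>v (2 * g)) x = x"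
  by (intro eq_vecI) (auto simp: transvection_def)

lemma partner_shift: "j \<ge> 2 \<Longrightarrow> partner j = partner (j - 2) + 2"
  by (auto simp: partner_def elim!: oddE)

text \<open>
  When $a$ lies in the plane or in its complement, $a_i a_{\<sigma>(j)}$ vanishes for $i$ and $j$
  on different sides, where $\<sigma>(j)$ is the partner of $j$. So the matrix has two diagonal
  blocks, themselves transvections along the two parts of $a$, one of which is the identity.
\<close>

lemma transvection_mat_in_Sp_block:
  assumes a: "a \<in> plane g \<union> plane_perp g" "omega1 g a = 1" and g: "g \<ge> 1"
  shows "transvection_mat g a \<in> Sp_block g"
proof -
  let ?h = "g - 1" and ?b = "vec 2 (\<lambda>i. a $ i)" and ?c = "tail_vec g a"
  let ?A = "transvection_mat 1 ?b" and ?D = "transvection_mat ?h ?c"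
  have ac: "a \<in> carrier_vec (2 * g)" using a by (auto simp: plane_def plane_perp_def)
  have A: "?A \<in> Sp 1" by (intro transvection_mat_in_Sp) simp
  have "omega0 ?h (transvection ?h ?c x) = omega0 ?h x" if x: "x \<in> carrier_vec (2 * ?h)" for x
  proof (cases "a \<in> plane g")
    case True
    then have "?c = 0\<^sub>v (2 * ?h)" by (auto simp: plane_def tail_vec_def)
    with x show ?thesis by (simp add: transvection_zero)
  next
    case False
    then have "omega0 ?h ?c = 1" using a g by (auto simp: plane_perp_def omega1_split)
    with x show ?thesis by (intro omega0_transvection) auto
  qed
  then have D: "?D \<in> Sp0 ?h"
    by (simp add: Sp0_def transvection_mat_in_Sp transvection_mat_mult_vec)
  have cross: "a $ i * a $ partner j = 0" "a $ j * a $ partner i = 0"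
    if "i < 2" "2 \<le> j" "j < 2 * g" for i j
    using a that partner_less[OF that(3)] partner_less[of i 1] partner_shift[OF that(2)]
    by (auto simp: plane_def plane_perp_def less_2_cases_iff)
  have "transvection_mat g a = four_block_mat ?A (0\<^sub>m 2 (2 * ?h)) (0\<^sub>m (2 * ?h) 2) ?D"
    (is "_ = ?F")
  proof (rule eq_matI)
    fix i j assume "i < dim_row ?F" "j < dim_col ?F"
    then have ij: "i < 2 * g" "j < 2 * g" using g by (auto simp: transvection_mat_def)
    have shift: "2 \<le> k \<Longrightarrow> Suc (Suc (k - 2)) = k" for k by simp
    show "transvection_mat g a $$ (i, j) = ?F $$ (i, j)"
      using ij shift[of i] shift[of j] cross[of i j] cross[of j i] partner_less[of j 1] partner_less[of "j - 2" ?h]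
        partner_shift[of j]
      by (auto simp: transvection_mat_def tail_vec_def not_less)
  qed (use g in \<open>auto simp: transvection_mat_def\<close>)
  with A D show ?thesis by (auto simp: Sp_block_def)
qed

text \<open>
  A symplectic map that fixes the plane pointwise maps its orthogonal complement into
  itself. On the complement \<^const>\<open>omega1\<close> restricts to the hyperbolic form of the
  last $2g-2$ coordinates, so the lower block preserves \<^const>\<open>omega0\<close>.
\<close>

lemma fixes_plane_imp_Sp_block:
  assumes g: "g \<ge> 1" and f: "f \<in> Sp1 g"
    and f0: "f *\<^sub>v unit_vec (2 * g) 0 = unit_vec (2 * g) 0"
    and f1: "f *\<^sub>v unit_vec (2 * g) 1 = unit_vec (2 * g) 1"
  shows "f \<in> Sp_block g"
proof -
  let ?n = "2 * g" and ?h = "g - 1"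
  let ?m = "2 * ?h"
  let ?D = "mat ?m ?m (\<lambda>(i, j). f $$ (i + 2, j + 2))"
  let ?Z = "0\<^sub>m 2 ?m" and ?Z' = "0\<^sub>m ?m 2"
  have fc: "f \<in> carrier_mat ?n ?n" and finv: "invertible_mat f" using f by (auto simp: Sp1_def Sp_def)
  have fform: "sympl_form g (f *\<^sub>v x) (f *\<^sub>v y) = sympl_form g x y"
    if "x \<in> carrier_vec ?n" "y \<in> carrier_vec ?n" for x y
    using f that by (auto simp: Sp1_def Sp_def)
  have fomega: "omega1 g (f *\<^sub>v x) = omega1 g x" if "x \<in> carrier_vec ?n" for x
    using f that by (auto simp: Sp1_def)
  have cols: "f $$ (i, k) = (if i = k then 1 else 0)" if "k < 2" "i < ?n" for i k
  proof -
    have k: "k < ?n" using that(1) g by linarith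
    have "f $$ (i, k) = (f *\<^sub>v unit_vec ?n k) $ i"
      using mult_unit_vec_index[OF fc that(2) k] by simp
    also have "\<dots> = unit_vec ?n k $ i" using f0 f1 that(1) by (auto simp: less_2_cases_iff)
    finally show ?thesis using that k by simp
  qed
  have rows: "f $$ (partner k, j) = 0" if "k < 2" "2 \<le> j" "j < ?n" for j k
  proof -
    have k: "k < ?n" using that by simp
    have fk: "f *\<^sub>v unit_vec ?n k = unit_vec ?n k" using f0 f1 that(1) by (auto simp: less_2_cases_iff)
    have "f $$ (partner k, j) = sympl_form g (unit_vec ?n k) (f *\<^sub>v unit_vec ?n j)"
      using fc that k partner_less[OF k]
      by (simp add: sympl_form_unit_left mult_unit_vec_index[of _ ?n])
    also have "\<dots> = sympl_form g (unit_vec ?n k) (unit_vec ?n j)"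
      using fform[of "unit_vec ?n k" "unit_vec ?n j"] fk by simp
    also have "\<dots> = 0" using that by (auto simp: sympl_form_unit_vec less_2_cases_iff)
    finally show ?thesis .
  qed
  have block: "f = four_block_mat (1\<^sub>m 2) ?Z ?Z' ?D" (is "_ = ?F")
  proof (rule eq_matI)
    fix i j assume "i < dim_row ?F" "j < dim_col ?F"
    then have ij: "i < ?n" "j < ?n" using g by auto
    have shift: "Suc (Suc (k - 2)) = k" if "0 < k" "k \<noteq> Suc 0" for k
      using that by linarith
    show "f $$ (i, j) = ?F $$ (i, j)"
      using ij shift[of i] shift[of j] cols[of j i] rows[of 0 j] rows[of 1 j]
      by (auto simp: partner_def less_2_cases_iff not_less)
  qed (use fc g in auto)
  have embed: "0\<^sub>v 2 @\<^sub>v x \<in> carrier_vec ?n" "tail_vec g (0\<^sub>v 2 @\<^sub>v x) = x"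
    "(0\<^sub>v 2 @\<^sub>v x) $ 0 = 0" "(0\<^sub>v 2 @\<^sub>v x) $ 1 = 0" if "x \<in> carrier_vec ?m" for x :: "bit vec"
  proof -
    have "0\<^sub>v 2 @\<^sub>v x \<in> carrier_vec (2 + ?m)" using that by (intro append_carrier_vec zero_carrier_vec)
    moreover have "2 + ?m = ?n" using g by simp
    ultimately show "0\<^sub>v 2 @\<^sub>v x \<in> carrier_vec ?n" by (simp only:)
    show "tail_vec g (0\<^sub>v 2 @\<^sub>v x) = x"
      using that by (intro eq_vecI) (simp_all add: tail_vec_def)
  qed (use that in simp_all)
  have f_embed: "f *\<^sub>v (0\<^sub>v 2 @\<^sub>v x) = 0\<^sub>v 2 @\<^sub>v (?D *\<^sub>v x)" if "x \<in> carrier_vec ?m" for x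
    by (subst block, subst four_block_mat_mult_vec[of _ 2 2 _ ?m _ ?m]) (use that in auto)
  have Dx: "?D *\<^sub>v x \<in> carrier_vec ?m" if "x \<in> carrier_vec ?m" for x
    using that by (intro mult_mat_vec_carrier[of _ _ ?m]) auto
  have "sympl_form ?h (?D *\<^sub>v x) (?D *\<^sub>v y) = sympl_form ?h x y"
    if "x \<in> carrier_vec ?m" "y \<in> carrier_vec ?m" for x y
    using fform[OF embed(1)[OF that(1)] embed(1)[OF that(2)]] that Dx g
    by (simp only: f_embed sympl_form_split embed mult_zero_left add_0_left)
  moreover have "omega0 ?h (?D *\<^sub>v x) = omega0 ?h x" if "x \<in> carrier_vec ?m" for x
    using fomega[OF embed(1)[OF that]] that Dx g
    by (simp only: f_embed omega1_split embed mult_zero_left add_0_left)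
  moreover have "invertible_mat ?D"
  proof -
    have "det f \<noteq> 0"
    proof -
      obtain h where h: "h \<in> carrier_mat ?n ?n" "f * h = 1\<^sub>m ?n"
        using finv fc invertible_mat_iff_right_inverse by blast
      then have "det f * det h = 1" using det_mult[OF fc h(1)] by simp
      then show ?thesis by (metis mult_zero_left zero_neq_one)
    qed
    moreover have "det f = det ?D"
      by (subst block, subst det_four_block_mat_lower_left_zero[of _ 2 _ ?m]) auto
    ultimately have "det ?D \<noteq> 0" by simp
    then have "?D \<in> Units (ring_mat TYPE(bit) ?m ())"
      by (intro det_non_zero_imp_unit) simp_all
    then obtain B where "B \<in> carrier_mat ?m ?m" "?D * B = 1\<^sub>m ?m"
      unfolding Units_def ring_mat_simps by blast
    then show ?thesis by (subst invertible_mat_iff_right_inverse[of _ ?m]) (simp, blast)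
  qed
  ultimately have D: "?D \<in> Sp0 ?h" by (simp add: Sp0_def Sp_def)
  have "invertible_mat (1\<^sub>m 2 :: bit mat)"
    by (subst invertible_mat_iff_right_inverse[of _ 2]) (simp_all add: bexI[of _ "1\<^sub>m 2"])
  then have "1\<^sub>m 2 \<in> Sp 1" by (simp add: Sp_def)
  with block D show ?thesis unfolding Sp_block_def by blast
qed

section \<open>The matrix B2 as a product of transvections\<close>

abbreviation e :: "nat \<Rightarrow> nat \<Rightarrow> bit vec" where
  "e g j \<equiv> unit_vec (2 * g) j"

text \<open>
  The two vectors are orthogonal, and composing gives $x \<mapsto> x + x_1 e_2 + (x_1 + x_4)(e_2 + e_3)$
  in the informal numbering, which is the action of $B_2$.
\<close>

lemma B2_eq_transvections:
  assumes g: "g \<ge> 2"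
  shows "B2 g = transvection_mat g (e g 1 + e g 2) * transvection_mat g (e g 1)"
    (is "_ = ?S * ?T")
proof (rule eq_matI)
  let ?n = "2 * g"
  have TT: "?S * ?T \<in> carrier_mat ?n ?n"
    by (intro mult_carrier_mat[of _ _ ?n] transvection_mat_carrier)
  fix i j assume "i < dim_row (?S * ?T)" "j < dim_col (?S * ?T)"
  then have ij: "i < ?n" "j < ?n" by (auto simp: transvection_mat_def)
  have "(?S * ?T) $$ (i, j) = ((?S * ?T) *\<^sub>v e g j) $ i"
    using mult_unit_vec_index[OF TT ij] by simp
  also have "(?S * ?T) *\<^sub>v e g j = transvection g (e g 1 + e g 2) (transvection g (e g 1) (e g j))"
    by (simp add: assoc_mult_mat_vec[of _ ?n ?n _ ?n] transvection_mat_mult_vec)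
  also have "\<dots> $ i = (if i = j then 1 else 0) + (if j = 0 \<and> i = 2 \<or> j = 3 \<and> (i = 1 \<or> i = 2) then 1 else 0)"
    using ij g
    by (auto simp: transvection_def sympl_form_add_left sympl_form_add_right sympl_form_smult_left
        sympl_form_unit_vec)
  also have "\<dots> = B2 g $$ (i, j)"
  proof (cases "i < 4 \<and> j < 4")
    case True
    then have "i \<in> {0, 1, 2, 3}" "j \<in> {0, 1, 2, 3}" by auto
    then show ?thesis by (auto simp: B2_def A2_def mat_of_rows_list_def)
  next
    case False
    then show ?thesis using ij by (auto simp: B2_def A2_def mat_of_rows_list_def)
  qed
  finally show "B2 g $$ (i, j) = (?S * ?T) $$ (i, j)" ..
qed (use g in \<open>auto simp: B2_def A2_def mat_of_rows_list_def transvection_mat_def\<close>)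

section \<open>Products of transvections acting on vectors\<close>

definition nonsingular :: "nat \<Rightarrow> bit vec set" where
  "nonsingular g = {a \<in> carrier_vec (2 * g). omega1 g a = 1}"

lemma foldr_transvection_carrier:
  "\<lbrakk>set as \<subseteq> carrier_vec (2 * g); x \<in> carrier_vec (2 * g)\<rbrakk> \<Longrightarrow>
     foldr (transvection g) as x \<in> carrier_vec (2 * g)"
  by (induction as) auto

lemma foldr_transvection_add:
  assumes "set as \<subseteq> carrier_vec (2 * g)" "x \<in> carrier_vec (2 * g)" "y \<in> carrier_vec (2 * g)"
  shows "foldr (transvection g) as (x + y) = foldr (transvection g) as x + foldr (transvection g) as y"
  using assms
proof (induction as)
  case (Cons a as)
  then have c: "foldr (transvection g) as x \<in> carrier_vec (2 * g)"
    "foldr (transvection g) as y \<in> carrier_vec (2 * g)" "a \<in> carrier_vec (2 * g)"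
    by (auto intro!: foldr_transvection_carrier)
  have "transvection g a (x + y) = transvection g a x + transvection g a y"
    if "x \<in> carrier_vec (2 * g)" "y \<in> carrier_vec (2 * g)" for x y
    using that c(3) by (intro eq_vecI) (auto simp: transvection_def sympl_form_add_left algebra_simps)
  with Cons c show ?case by simp
qed auto

lemma sympl_form_foldr_transvection:
  assumes "set as \<subseteq> carrier_vec (2 * g)" "x \<in> carrier_vec (2 * g)" "y \<in> carrier_vec (2 * g)"
  shows "sympl_form g (foldr (transvection g) as x) (foldr (transvection g) as y) = sympl_form g x y"
  using assms
  by (induction as) (auto simp: sympl_form_transvection foldr_transvection_carrier)

lemma omega1_foldr_transvection:
  assumes "set as \<subseteq> nonsingular g" "x \<in> carrier_vec (2 * g)" "g \<ge> 1"
  shows "omega1 g (foldr (transvection g) as x) = omega1 g x"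
  using assms
proof (induction as)
  case (Cons a as)
  then have "foldr (transvection g) as x \<in> carrier_vec (2 * g)"
    by (intro foldr_transvection_carrier) (auto simp: nonsingular_def)
  with Cons show ?case by (auto simp: omega1_transvection nonsingular_def)
qed auto

lemma sympl_form_plane_perp:
  assumes "p \<in> plane g" "w \<in> plane_perp g" shows "sympl_form g p w = 0"
  unfolding sympl_form_eq_sum_partner
proof (intro sum.neutral ballI)
  fix j assume "j \<in> {..<2 * g}"
  then show "p $ j * w $ partner j = 0"
    using assms by (cases "j < 2") (auto simp: plane_def plane_perp_def partner_def less_2_cases_iff)
qed

lemma foldr_transvection_fix:
  assumes "\<forall>a \<in> set as. a \<in> carrier_vec (2 * g) \<and> sympl_form g x a = 0" "x \<in> carrier_vec (2 * g)"
  shows "foldr (transvection g) as x = x"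
  using assms
proof (induction as)
  case (Cons a as)
  then show ?case by (intro eq_vecI) (auto simp: transvection_def)
qed auto

text \<open>
  The basic step inside an orbit. If moreover $q(x) = q(y)$, then $q(x + y) = x.y = 1$, so that the
  transvection used here preserves $q$.
\<close>

lemma transvection_swap:
  assumes "x \<in> carrier_vec (2 * g)" "y \<in> carrier_vec (2 * g)" "sympl_form g x y = 1"
  shows "transvection g (x + y) x = y"
  using assms
  by (intro eq_vecI) (auto simp: transvection_def sympl_form_add_right sympl_form_self)

lemma plane_perp_add: "\<lbrakk>x \<in> plane_perp g; y \<in> plane_perp g; g \<ge> 1\<rbrakk> \<Longrightarrow> x + y \<in> plane_perp g"
  by (auto simp: plane_perp_def)

lemma foldr_transvection_plane_perp:
  assumes "set as \<subseteq> plane_perp g" "x \<in> plane_perp g" "g \<ge> 1"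
  shows "foldr (transvection g) as x \<in> plane_perp g"
  using assms
proof (induction as)
  case (Cons a as)
  then show ?case by (auto simp: transvection_def plane_perp_def)
qed auto

lemma plane_perp_nonzero_coordinate:
  assumes "w \<in> plane_perp g" "w \<noteq> 0\<^sub>v (2 * g)"
  obtains j where "j < 2 * g" "w $ j = 1" "j \<ge> 2"
proof -
  have dim: "dim_vec w = 2 * g" using assms(1) by (simp add: plane_perp_def)
  have "\<exists>j < 2 * g. w $ j \<noteq> 0"
  proof (rule ccontr)
    assume "\<not> (\<exists>j < 2 * g. w $ j \<noteq> 0)"
    then have "w = 0\<^sub>v (2 * g)" using dim by (intro eq_vecI) auto
    with assms(2) show False by contradiction
  qed
  then obtain j where j: "j < 2 * g" "w $ j = 1" by auto
  have "j \<ge> 2"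
  proof (rule ccontr)
    assume "\<not> j \<ge> 2"
    then show False using j assms(1) by (auto simp: plane_perp_def less_2_cases_iff not_le)
  qed
  with j show ?thesis by (rule that)
qed

lemma unit_vec_plane_perp:
  assumes "2 \<le> i" "i < 2 * g"
  shows "e g i \<in> plane_perp g" "omega1 g (e g i) = 0"
proof -
  show "e g i \<in> plane_perp g" using assms by (auto simp: plane_perp_def)
  show "omega1 g (e g i) = 0"
    using assms by (auto simp: omega1_def omega0_def intro!: sum.neutral)
qed

text \<open>
  If $w$ has product 1 with the target \<open>e g 2\<close>, a single transvection suffices. If it has
  product 0 and is not the target itself, a singular $z$ in the complement having product 1 with
  both serves as a stepping stone.
\<close>

lemma singular_to_e2:
  assumes g: "g \<ge> 1" and w: "w \<in> plane_perp g" "w \<noteq> 0\<^sub>v (2 * g)" "omega1 g w = 0"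
  shows "g \<ge> 2 \<and> (\<exists>as. set as \<subseteq> plane_perp g \<inter> nonsingular g \<and> foldr (transvection g) as w = e g 2)"
proof -
  have wc: "w \<in> carrier_vec (2 * g)" using w by (simp add: plane_perp_def)
  obtain j where j: "j < 2 * g" "w $ j = 1" and j2: "j \<ge> 2"
    using plane_perp_nonzero_coordinate[OF w(1,2)] .
  then have g2: "g \<ge> 2" by simp
  have step: "set [x + y] \<subseteq> plane_perp g \<inter> nonsingular g \<and> foldr (transvection g) [x + y] x = y"
    if "x \<in> plane_perp g" "y \<in> plane_perp g" "omega1 g x = 0" "omega1 g y = 0" "sympl_form g x y = 1" for x y
    using that g plane_perp_add[of x g y]
    by (auto simp: nonsingular_def plane_perp_def omega1_add transvection_swap)
  note unit = unit_vec_plane_perp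
  have form_e: "sympl_form g x (e g i) = x $ partner i" if "i < 2 * g" for x i
    using sympl_form_unit_left[OF that] sympl_form_commute by metis
  have partner: "partner 2 = 3" "partner 3 = 2" by (auto simp: partner_def)
  show ?thesis
  proof (cases "w $ 3 = 1")
    case True
    then have "set [w + e g 2] \<subseteq> plane_perp g \<inter> nonsingular g \<and> foldr (transvection g) [w + e g 2] w = e g 2"
      using unit[of 2] g2 w form_e[of 2 w] partner by (intro step) auto
    with g2 show ?thesis by blast
  next
    case False
    show ?thesis
    proof (cases "w = e g 2")
      case True
      then show ?thesis using g2 by (intro conjI exI[of _ "[]"]) auto
    next
      case ne: False
      have "\<exists>z. z \<in> plane_perp g \<and> omega1 g z = 0 \<and> sympl_form g w z = 1 \<and> sympl_form g z (e g 2) = 1"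
      proof (cases "w $ 2 = 1")
        case True
        then show ?thesis
          using unit[of 3] g2 form_e by (intro exI[of _ "e g 3"]) (auto simp: partner)
      next
        case w2: False
        then have j4: "j \<ge> 4" using j j2 \<open>w $ 3 \<noteq> 1\<close> by (cases "j = 2"; cases "j = 3") auto
        let ?k = "partner j"
        \<comment> \<open>The partner of the target pairs to 0 with the vector, so a basis vector of another
            hyperbolic pair is added to it; orthogonal singular vectors have a singular sum.\<close>
        have k: "?k < 2 * g" "partner ?k = j" "?k \<ge> 4"
          using partner_less[OF j(1)] j4 by (auto simp: partner_def elim!: oddE)
        have 3: "3 < 2 * g" using g2 by simp
        have "sympl_form g (e g 3) (e g ?k) = 0"
          using 3 k j4 j(1) by (simp add: form_e)
        then show ?thesis
          using unit[of 3] unit[of ?k] g2 k 3 j w2 j4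
          by (intro exI[of _ "e g 3 + e g ?k"])
            (auto simp: partner form_e omega1_add sympl_form_add_right plane_perp_add)
      qed
      then obtain z where z: "z \<in> plane_perp g" "omega1 g z = 0" "sympl_form g w z = 1"
        "sympl_form g z (e g 2) = 1" by blast
      have "set [z + e g 2, w + z] \<subseteq> plane_perp g \<inter> nonsingular g \<and>
          foldr (transvection g) [z + e g 2, w + z] w = e g 2"
        using step[of w z] step[of z "e g 2"] z w unit[of 2] g2 by auto
      then show ?thesis using g2 by blast
    qed
  qed
qed

text \<open>
  Some basis vector of the complement has product 1 with $w$. It is singular, so it can be moved to
  \<open>e g 2\<close>; the image of $w$ then has product 1 with \<open>e g 2\<close>, and this product is its coordinate 3.
\<close>

lemma nonzero_to_coordinate3_eq_1:
  assumes g: "g \<ge> 1" and w: "w \<in> plane_perp g" "w \<noteq> 0\<^sub>v (2 * g)"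
  shows "g \<ge> 2 \<and> (\<exists>as. set as \<subseteq> plane_perp g \<inter> nonsingular g \<and> foldr (transvection g) as w $ 3 = 1)"
proof -
  have wc: "w \<in> carrier_vec (2 * g)" using w by (simp add: plane_perp_def)
  obtain j where j: "j < 2 * g" "w $ j = 1" and j2: "j \<ge> 2"
    using plane_perp_nonzero_coordinate[OF w(1,2)] .
  let ?k = "partner j"
  have k: "?k < 2 * g" "partner ?k = j" "?k \<ge> 2"
    using partner_less[OF j(1)] j2 by (auto simp: partner_def elim!: oddE)
  have "e g ?k \<in> plane_perp g" "omega1 g (e g ?k) = 0"
    using k by (auto intro: unit_vec_plane_perp)
  moreover have "e g ?k \<noteq> 0\<^sub>v (2 * g)" using k(1) by (metis index_unit_vec(1) index_zero_vec(1) zero_neq_one)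
  ultimately obtain as where as: "g \<ge> 2" "set as \<subseteq> plane_perp g \<inter> nonsingular g"
    "foldr (transvection g) as (e g ?k) = e g 2"
    using singular_to_e2[OF g] by blast
  have asc: "set as \<subseteq> carrier_vec (2 * g)" using as(2) by (auto simp: nonsingular_def)
  have "foldr (transvection g) as w $ 3 = sympl_form g (e g 2) (foldr (transvection g) as w)"
    using as(1) by (simp add: sympl_form_unit_left partner_def)
  also have "\<dots> = sympl_form g (e g ?k) w"
    unfolding as(3)[symmetric] using asc wc by (intro sympl_form_foldr_transvection) auto
  also have "\<dots> = 1" using k j by (simp add: sympl_form_unit_left)
  finally show ?thesis using as by blast
qed

text \<open>
  The directions whose transvections can be expressed by the given generators. The sum of
  \<open>e g 1\<close> and \<open>e g 2\<close> is the only one that mixes the plane with its complement.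
\<close>

definition admissible :: "nat \<Rightarrow> bit vec set" where
  "admissible g = (plane g \<union> plane_perp g) \<inter> nonsingular g \<union> (if g \<ge> 2 then {e g 1 + e g 2} else {})"

lemma admissible_unit:
  assumes "g \<ge> 1"
  shows "e g 0 \<in> plane g \<inter> nonsingular g" "e g 1 \<in> plane g \<inter> nonsingular g"
    "e g 0 + e g 1 \<in> plane g \<inter> nonsingular g"
proof -
  have "omega0 g (e g 0) = 0" "omega0 g (e g 1) = 0"
    by (auto simp: omega0_def intro!: sum.neutral)
  then show "e g 0 \<in> plane g \<inter> nonsingular g" "e g 1 \<in> plane g \<inter> nonsingular g"
    "e g 0 + e g 1 \<in> plane g \<inter> nonsingular g"
    using assms
    by (auto simp: plane_def nonsingular_def omega1_def omega0_add sympl_form_unit_vec)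
qed

lemma omega1_e1_e2: "g \<ge> 2 \<Longrightarrow> omega1 g (e g 1 + e g 2) = 1"
  using admissible_unit(2)[of g]
  by (auto simp: omega1_add nonsingular_def sympl_form_unit_vec)
    (auto simp: omega1_def omega0_def intro!: sum.neutral)

lemma admissible_nonsingular: "g \<ge> 1 \<Longrightarrow> admissible g \<subseteq> nonsingular g"
  using omega1_e1_e2[of g] by (auto simp: admissible_def nonsingular_def)

lemma plane_decomposition:
  assumes "x \<in> carrier_vec (2 * g)" "g \<ge> 1"
  obtains p w where "p \<in> plane g" "w \<in> plane_perp g" "x = p + w" "p $ 0 = x $ 0" "p $ 1 = x $ 1"
    "omega1 g x = omega1 g p + omega1 g w"
proof
  let ?p = "vec (2 * g) (\<lambda>i. if i < 2 then x $ i else 0)"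
  let ?w = "vec (2 * g) (\<lambda>i. if i < 2 then 0 else x $ i)"
  show p: "?p \<in> plane g" and w: "?w \<in> plane_perp g" using assms by (auto simp: plane_def plane_perp_def)
  show x: "x = ?p + ?w" using assms by (intro eq_vecI) auto
  show "?p $ 0 = x $ 0" "?p $ 1 = x $ 1" using assms by auto
  have "omega1 g (?p + ?w) = omega1 g ?p + omega1 g ?w"
    using sympl_form_plane_perp[OF p w] assms by (simp add: omega1_add)
  with x show "omega1 g x = omega1 g ?p + omega1 g ?w" by simp
qed

lemma plane_cases:
  assumes "p \<in> plane g" "g \<ge> 1"
  shows "p = 0\<^sub>v (2 * g) \<or> p = e g 0 \<or> p = e g 1 \<or> p = e g 0 + e g 1"
proof -
  have "p = p $ 0 \<cdot>\<^sub>v e g 0 + p $ 1 \<cdot>\<^sub>v e g 1"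
    using assms by (intro eq_vecI) (auto simp: plane_def not_less_eq_eq less_2_cases_iff)
  moreover have "p $ 0 = 0 \<or> p $ 0 = 1" "p $ 1 = 0 \<or> p $ 1 = 1" by (metis bit_not_zero_iff)+
  moreover have "0 \<cdot>\<^sub>v v = 0\<^sub>v (2 * g)" "1 \<cdot>\<^sub>v v = v" if "v \<in> carrier_vec (2 * g)" for v :: "bit vec"
    using that by (auto intro!: eq_vecI)
  ultimately show ?thesis by (elim disjE) simp_all
qed

section \<open>Transitivity on the nonsingular vectors and pairs\<close>

lemma transvection_basis:
  assumes g: "g \<ge> 1"
  shows "transvection g (e g 0) (e g 0) = e g 0"
    and "transvection g (e g 0) (e g 0 + e g 1) = e g 1"
    and "transvection g (e g 1) (e g 0 + e g 1) = e g 0"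
    and "transvection g (e g 0 + e g 1) (e g 0) = e g 1"
    and "transvection g (e g 0 + e g 1) (e g 1) = e g 0"
    and "transvection g (e g 0 + e g 1) (e g 0 + e g 1) = e g 0 + e g 1"
proof -
  have form: "sympl_form g (e g 0) (e g 1) = 1" "sympl_form g (e g 1) (e g 0) = 1"
    using g by (auto simp: sympl_form_unit_vec)
  note [simp] = form[unfolded One_nat_def]
  show "transvection g (e g 0) (e g 0) = e g 0"
    "transvection g (e g 0) (e g 0 + e g 1) = e g 1"
    "transvection g (e g 1) (e g 0 + e g 1) = e g 0"
    "transvection g (e g 0 + e g 1) (e g 0) = e g 1"
    "transvection g (e g 0 + e g 1) (e g 1) = e g 0"
    "transvection g (e g 0 + e g 1) (e g 0 + e g 1) = e g 0 + e g 1"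
    by (intro eq_vecI; simp add: transvection_def sympl_form_add_left sympl_form_add_right
        sympl_form_self add.assoc add.commute add.left_commute)+
qed

lemma transvection_e1_e2:
  assumes g: "g \<ge> 2"
  shows "transvection g (e g 1 + e g 2) (e g 1) = e g 1"
    and "transvection g (e g 1 + e g 2) (e g 0 + e g 2) = e g 0 + e g 1"
    and "transvection g (e g 0 + e g 1) (e g 1 + e g 2) = e g 0 + e g 2"
proof -
  have form: "sympl_form g (e g 0) (e g 1) = 1" "sympl_form g (e g 1) (e g 0) = 1"
    "sympl_form g (e g 0) (e g 2) = 0" "sympl_form g (e g 2) (e g 0) = 0"
    "sympl_form g (e g 1) (e g 2) = 0" "sympl_form g (e g 2) (e g 1) = 0"
    using g by (auto simp: sympl_form_unit_vec)
  note [simp] = form[unfolded One_nat_def]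
  show "transvection g (e g 1 + e g 2) (e g 1) = e g 1"
    "transvection g (e g 1 + e g 2) (e g 0 + e g 2) = e g 0 + e g 1"
    "transvection g (e g 0 + e g 1) (e g 1 + e g 2) = e g 0 + e g 2"
    by (intro eq_vecI; simp add: transvection_def sympl_form_add_left sympl_form_add_right
        sympl_form_self add.assoc add.commute add.left_commute)+
qed

text \<open>
  The component in the plane is nonzero, hence nonsingular, and can be moved to \<open>e g 0\<close> inside the
  plane. The other component is then singular: it is zero or can be moved to \<open>e g 2\<close>, and two more
  transvections take \<open>e g 0 + e g 2\<close> to \<open>e g 0\<close>.
\<close>

lemma nonsingular_to_e0_outside_plane_perp:
  assumes g: "g \<ge> 1" and u: "u \<in> nonsingular g" "u \<notin> plane_perp g"
  shows "\<exists>as. set as \<subseteq> admissible g \<and> foldr (transvection g) as u = e g 0"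
proof -
  obtain p w where pw: "p \<in> plane g" "w \<in> plane_perp g" "u = p + w" "p $ 0 = u $ 0" "p $ 1 = u $ 1"
    "omega1 g u = omega1 g p + omega1 g w"
    by (rule plane_decomposition[of u g]) (use u g in \<open>auto simp: nonsingular_def\<close>)
  have wc: "w \<in> carrier_vec (2 * g)" "p \<in> carrier_vec (2 * g)" using pw by (auto simp: plane_def plane_perp_def)
  note units = admissible_unit[OF g]
  have "p \<noteq> 0\<^sub>v (2 * g)" using pw u g by (auto simp: plane_perp_def nonsingular_def)
  then consider "p = e g 0" | "p = e g 1" | "p = e g 0 + e g 1" using plane_cases[OF pw(1) g] by blast
  then have "p \<in> nonsingular g \<and> (\<exists>bs. set bs \<subseteq> plane g \<inter> nonsingular g \<and> foldr (transvection g) bs p = e g 0)"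
  proof cases
    case 1
    then show ?thesis using units by (auto intro!: exI[of _ "[]"])
  next
    case 2
    then show ?thesis using units transvection_basis(5)[OF g] by (auto intro!: exI[of _ "[e g 0 + e g 1]"])
  next
    case 3
    then show ?thesis using units transvection_basis(3)[OF g] by (auto intro!: exI[of _ "[e g 1]"])
  qed
  then obtain bs where bs: "p \<in> nonsingular g" "set bs \<subseteq> plane g \<inter> nonsingular g" "foldr (transvection g) bs p = e g 0"
    by blast
  have "foldr (transvection g) bs w = w"
    using bs(2) pw(2) sympl_form_plane_perp sympl_form_commute[of g w] wc
    by (intro foldr_transvection_fix) (auto simp: plane_def)
  then have bsu: "foldr (transvection g) bs u = e g 0 + w"
    using bs pw(3) wc by (subst pw(3), subst foldr_transvection_add) (auto simp: plane_def)
  have bsa: "set bs \<subseteq> admissible g" using bs(2) by (auto simp: admissible_def)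
  have w0: "omega1 g w = 0" using pw(6) bs(1) u by (auto simp: nonsingular_def)
  show ?thesis
  proof (cases "w = 0\<^sub>v (2 * g)")
    case True
    then show ?thesis using bsu bsa by (intro exI[of _ bs]) auto
  next
    case False
    then obtain as where g2: "g \<ge> 2" and as: "set as \<subseteq> plane_perp g \<inter> nonsingular g" "foldr (transvection g) as w = e g 2"
      using singular_to_e2[OF g pw(2) _ w0] by blast
    have "foldr (transvection g) as (e g 0) = e g 0"
      using as(1) sympl_form_plane_perp units(1)
      by (intro foldr_transvection_fix) (auto simp: plane_perp_def)
    then have 1: "foldr (transvection g) as (e g 0 + w) = e g 0 + e g 2"
      using as wc by (subst foldr_transvection_add) (auto simp: plane_perp_def)
    have "foldr (transvection g) ([e g 1, e g 1 + e g 2] @ as @ bs) u = e g 0"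
      unfolding foldr_append bsu 1 using transvection_e1_e2(2)[OF g2] transvection_basis(3)[OF g] by simp
    moreover have "set ([e g 1, e g 1 + e g 2] @ as @ bs) \<subseteq> admissible g"
      using as(1) bsa units(2) g2 by (auto simp: admissible_def)
    ultimately show ?thesis by blast
  qed
qed

text \<open>
  A vector of the complement is made to leave it by the mixed transvection, which adds to the
  vector the multiple of \<open>e g 1 + e g 2\<close> given by its coordinate 3.
\<close>

lemma nonsingular_to_e0:
  assumes g: "g \<ge> 1" and u: "u \<in> nonsingular g"
  shows "\<exists>as. set as \<subseteq> admissible g \<and> foldr (transvection g) as u = e g 0"
proof (cases "u \<in> plane_perp g")
  case False
  then show ?thesis using nonsingular_to_e0_outside_plane_perp g u by blast
next
  case True
  have uc: "u \<in> carrier_vec (2 * g)" using u by (simp add: nonsingular_def)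
  have "omega1 g (0\<^sub>v (2 * g)) = 0" using g by (auto simp: omega1_def omega0_def)
  then have "u \<noteq> 0\<^sub>v (2 * g)" using u by (auto simp: nonsingular_def)
  then obtain as where g2: "g \<ge> 2" and as: "set as \<subseteq> plane_perp g \<inter> nonsingular g"
      "foldr (transvection g) as u $ 3 = 1"
    using nonzero_to_coordinate3_eq_1[OF g True] by blast
  let ?v = "foldr (transvection g) as u"
  let ?x = "transvection g (e g 1 + e g 2) ?v"
  have v: "?v \<in> plane_perp g" using as True g by (intro foldr_transvection_plane_perp) auto
  then have vc: "?v \<in> carrier_vec (2 * g)" by (simp add: plane_perp_def)
  have adm: "set ((e g 1 + e g 2) # as) \<subseteq> admissible g" using as(1) g2 by (auto simp: admissible_def)
  have "sympl_form g ?v (e g 1 + e g 2) = 1"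
    using g2 v vc as(2) sympl_form_commute[of g ?v]
    by (simp add: sympl_form_add_left sympl_form_unit_left partner_def plane_perp_def)
  then have "?x $ 1 = 1" using v g2 by (auto simp: transvection_def plane_perp_def)
  then have "?x \<notin> plane_perp g" by (auto simp: plane_perp_def)
  moreover have "foldr (transvection g) ((e g 1 + e g 2) # as) u \<in> nonsingular g"
    unfolding nonsingular_def
    using adm admissible_nonsingular[OF g] u uc g
      omega1_foldr_transvection[of "(e g 1 + e g 2) # as" g u]
      foldr_transvection_carrier[of "(e g 1 + e g 2) # as" g u]
    by (auto simp: nonsingular_def)
  ultimately obtain bs where bs: "set bs \<subseteq> admissible g" "foldr (transvection g) bs ?x = e g 0"
    using nonsingular_to_e0_outside_plane_perp[OF g, of ?x] by auto
  have "foldr (transvection g) (bs @ (e g 1 + e g 2) # as) u = e g 0" using bs(2) by simp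
  moreover have "set (bs @ (e g 1 + e g 2) # as) \<subseteq> admissible g" using bs(1) adm by auto
  ultimately show ?thesis by blast
qed

text \<open>
  Product 1 with \<open>e g 0\<close> forces the component in the plane to be \<open>e g 1\<close>, up to adding
  \<open>e g 0\<close>. The complementary component is singular and is moved to \<open>e g 2\<close>; it remains to
  absorb it without moving \<open>e g 0\<close>.
\<close>

lemma nonsingular_to_e1_fixing_e0:
  assumes g: "g \<ge> 1" and v: "v \<in> nonsingular g" "sympl_form g (e g 0) v = 1"
  shows "\<exists>as. set as \<subseteq> admissible g \<and> foldr (transvection g) as (e g 0) = e g 0 \<and>
     foldr (transvection g) as v = e g 1"
proof -
  note units = admissible_unit[OF g]
  have units_adm: "e g 0 \<in> admissible g" "e g 1 \<in> admissible g" "e g 0 + e g 1 \<in> admissible g"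
    using units by (auto simp: admissible_def)
  obtain p w where pw: "p \<in> plane g" "w \<in> plane_perp g" "v = p + w" "p $ 0 = v $ 0" "p $ 1 = v $ 1"
    "omega1 g v = omega1 g p + omega1 g w"
    by (rule plane_decomposition[of v g]) (use v g in \<open>auto simp: nonsingular_def\<close>)
  have wc: "w \<in> carrier_vec (2 * g)" "p \<in> carrier_vec (2 * g)" using pw by (auto simp: plane_def plane_perp_def)
  have "p $ 1 = 1" using v(2) pw(5) g by (simp add: sympl_form_unit_left partner_def)
  then have p: "p = e g 1 \<or> p = e g 0 + e g 1" using plane_cases[OF pw(1) g] g by auto
  have "\<exists>bs. set bs \<subseteq> plane g \<inter> nonsingular g \<and> foldr (transvection g) bs (e g 0) = e g 0 \<and>
      foldr (transvection g) bs p = e g 1"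
  proof (cases "p = e g 1")
    case True
    then show ?thesis by (intro exI[of _ "[]"]) auto
  next
    case False
    then show ?thesis using p transvection_basis[OF g] units(1) by (intro exI[of _ "[e g 0]"]) auto
  qed
  then obtain bs where bs: "set bs \<subseteq> plane g \<inter> nonsingular g"
    "foldr (transvection g) bs (e g 0) = e g 0" "foldr (transvection g) bs p = e g 1"
    by blast
  have "foldr (transvection g) bs w = w"
    using bs(1) pw(2) sympl_form_plane_perp sympl_form_commute[of g w] wc
    by (intro foldr_transvection_fix) (auto simp: plane_def)
  then have bsv: "foldr (transvection g) bs v = e g 1 + w"
    using bs pw(3) wc by (subst pw(3), subst foldr_transvection_add) (auto simp: plane_def)
  have bsa: "set bs \<subseteq> admissible g" using bs(1) by (auto simp: admissible_def)
  have w0: "omega1 g w = 0" using pw(6) p units v by (auto simp: nonsingular_def)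
  show ?thesis
  proof (cases "w = 0\<^sub>v (2 * g)")
    case True
    then show ?thesis using bsv bsa bs(2) by (intro exI[of _ bs]) auto
  next
    case False
    then obtain as where g2: "g \<ge> 2" and as: "set as \<subseteq> plane_perp g \<inter> nonsingular g" "foldr (transvection g) as w = e g 2"
      using singular_to_e2[OF g pw(2) _ w0] by blast
    have stab: "foldr (transvection g) as (e g i) = e g i" if "i < 2" for i
      using as(1) sympl_form_plane_perp units(1,2) that
      by (intro foldr_transvection_fix) (auto simp: plane_perp_def less_2_cases_iff)
    then have 1: "foldr (transvection g) as (e g 1 + w) = e g 1 + e g 2"
      using as wc by (subst foldr_transvection_add) (auto simp: plane_perp_def)
    \<comment> \<open>The last three conjugate the mixed transvection by the swap of \<open>e g 0\<close> and \<open>e g 1\<close>. This gives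
        the transvection along \<open>e g 0 + e g 2\<close>, which fixes \<open>e g 0\<close>.\<close>
    let ?cs = "[e g 0, e g 0 + e g 1, e g 1 + e g 2, e g 0 + e g 1]"
    have 2: "foldr (transvection g) ?cs (e g 0) = e g 0"
      "foldr (transvection g) ?cs (e g 1 + e g 2) = e g 1"
      using transvection_basis[OF g] transvection_e1_e2[OF g2] by simp_all
    have "foldr (transvection g) (?cs @ as @ bs) (e g 0) = e g 0"
      unfolding foldr_append bs(2) stab[OF pos2] by (rule 2)
    moreover have "foldr (transvection g) (?cs @ as @ bs) v = e g 1"
      unfolding foldr_append bsv 1 by (rule 2)
    moreover have "set (?cs @ as @ bs) \<subseteq> admissible g"
      using as(1) bsa units_adm g2 by (auto simp: admissible_def)
    ultimately show ?thesis by blast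
  qed
qed

section \<open>Generation\<close>

definition generated :: "nat \<Rightarrow> bit mat set" where
  "generated g = {foldr (*) Ms (1\<^sub>m (2 * g)) | Ms. \<forall>M \<in> set Ms. M \<in> Sp_block g \<or> (g \<ge> 2 \<and> M = B2 g)}"

lemma generated_mult:
  assumes "M \<in> Sp_block g \<or> (g \<ge> 2 \<and> M = B2 g)" "X \<in> generated g"
  shows "M * X \<in> generated g"
proof -
  obtain Ms where "X = foldr (*) Ms (1\<^sub>m (2 * g))" "\<forall>M \<in> set Ms. M \<in> Sp_block g \<or> (g \<ge> 2 \<and> M = B2 g)"
    using assms(2) by (auto simp: generated_def)
  then show ?thesis using assms(1) unfolding generated_def by (intro CollectI exI[of _ "M # Ms"]) auto
qed

text \<open>
  For the mixed direction, insert the square of $t_{e_2}$, which is the identity, so that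
  $t_{e_2+e_3} X = (t_{e_2+e_3} t_{e_2}) (t_{e_2} X) = B_2 (t_{e_2} X)$ in the informal numbering.
\<close>

lemma transvection_mult_generated:
  assumes g: "g \<ge> 1" and a: "a \<in> admissible g" and X: "X \<in> generated g" "X \<in> carrier_mat (2 * g) (2 * g)"
  shows "transvection_mat g a * X \<in> generated g"
proof (cases "a \<in> plane g \<union> plane_perp g \<and> omega1 g a = 1")
  case True
  then show ?thesis using generated_mult transvection_mat_in_Sp_block g X by blast
next
  case False
  then have g2: "g \<ge> 2" and a: "a = e g 1 + e g 2"
    using a by (auto simp: admissible_def nonsingular_def split: if_splits)
  let ?n = "2 * g" and ?S = "transvection_mat g a" and ?T = "transvection_mat g (e g 1)"
  have T: "?S \<in> carrier_mat ?n ?n" "?T \<in> carrier_mat ?n ?n" "?T * X \<in> carrier_mat ?n ?n"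
    using X by (auto intro!: mult_carrier_mat[of _ _ ?n])
  have "?S * X = ?S * ((?T * ?T) * X)" using X by (simp add: transvection_mat_involution)
  also have "\<dots> = (?S * ?T) * (?T * X)"
    using T X by (simp add: assoc_mult_mat[of _ ?n ?n _ ?n _ ?n])
  also have "\<dots> = B2 g * (?T * X)" using B2_eq_transvections[OF g2] a by simp
  finally have "?S * X = B2 g * (?T * X)" .
  moreover have "?T * X \<in> generated g"
    using admissible_unit(2)[OF g] g X
    by (intro generated_mult disjI1 transvection_mat_in_Sp_block) (auto simp: nonsingular_def)
  ultimately show ?thesis using generated_mult g2 by simp
qed

lemma foldr_transvection_mat:
  assumes g: "g \<ge> 1" and as: "set as \<subseteq> nonsingular g" and f: "f \<in> Sp1 g"
  shows "foldr (\<lambda>a M. transvection_mat g a * M) as f \<in> Sp1 g"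
    and "x \<in> carrier_vec (2 * g) \<Longrightarrow> foldr (\<lambda>a M. transvection_mat g a * M) as f *\<^sub>v x =
        foldr (transvection g) as (f *\<^sub>v x)"
proof -
  show "foldr (\<lambda>a M. transvection_mat g a * M) as f \<in> Sp1 g"
    using as by (induction as) (auto simp: f nonsingular_def intro!: transvection_mat_mult_in_Sp1 g)
  assume x: "x \<in> carrier_vec (2 * g)"
  show "foldr (\<lambda>a M. transvection_mat g a * M) as f *\<^sub>v x = foldr (transvection g) as (f *\<^sub>v x)"
    using as
  proof (induction as)
    case (Cons a as)
    let ?F = "foldr (\<lambda>a M. transvection_mat g a * M) as f"
    have "?F \<in> Sp1 g"
      using Cons.prems by (induction as) (auto simp: f nonsingular_def intro!: transvection_mat_mult_in_Sp1 g)
    then have F: "?F \<in> carrier_mat (2 * g) (2 * g)" by (simp add: Sp1_def Sp_def)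
    then have "?F *\<^sub>v x \<in> carrier_vec (2 * g)" using x by simp
    moreover have "(transvection_mat g a * ?F) *\<^sub>v x = transvection_mat g a *\<^sub>v (?F *\<^sub>v x)"
      by (rule assoc_mult_mat_vec[OF transvection_mat_carrier F x])
    ultimately have "(transvection_mat g a * ?F) *\<^sub>v x = transvection g a (?F *\<^sub>v x)"
      using Cons.prems by (simp add: nonsingular_def transvection_mat_mult_vec)
    with Cons show ?case by simp
  qed simp
qed

text \<open>
  Multiplying again by the same involutions, in reverse order, recovers $f$.
\<close>

lemma generated_of_foldr_transvection:
  assumes g: "g \<ge> 1" and as: "set as \<subseteq> admissible g" and f: "f \<in> Sp1 g"
    and "foldr (\<lambda>a M. transvection_mat g a * M) as f \<in> generated g"
  shows "f \<in> generated g"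
  using as assms(4)
proof (induction as)
  case (Cons a as)
  let ?n = "2 * g" and ?T = "transvection_mat g a"
  let ?F = "foldr (\<lambda>a M. transvection_mat g a * M) as f"
  have a: "a \<in> carrier_vec ?n" "a \<in> admissible g" and as: "set as \<subseteq> nonsingular g"
    using Cons.prems admissible_nonsingular[OF g] by (auto simp: nonsingular_def)
  have F: "?F \<in> carrier_mat ?n ?n"
    using foldr_transvection_mat(1)[OF g as f] by (simp add: Sp1_def Sp_def)
  have T: "?T \<in> carrier_mat ?n ?n" by simp
  have TF: "?T * ?F \<in> carrier_mat ?n ?n" by (rule mult_carrier_mat[OF T F])
  have "?T * ?F \<in> generated g" using Cons.prems(2) by simp
  then have "?T * (?T * ?F) \<in> generated g"
    by (rule transvection_mult_generated[OF g a(2) _ TF])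
  also have "?T * (?T * ?F) = ?F"
    using assoc_mult_mat[OF T T F] left_mult_one_mat[OF F] a by (simp add: transvection_mat_involution)
  finally have "?F \<in> generated g" .
  then show ?case using Cons.IH Cons.prems by simp
qed simp

theorem theorem21:
  fixes g :: nat and f :: "bit mat"
  assumes "g \<ge> 1" and "f \<in> Sp1 g"
  shows "\<exists>Ms. (\<forall>M \<in> set Ms. M \<in> Sp_block g \<or> (g \<ge> 2 \<and> M = B2 g)) \<and>
              f = foldr (*) Ms (1\<^sub>m (2 * g))"
proof -
  note g = assms(1)
  let ?n = "2 * g"
  have ns: "f *\<^sub>v x \<in> nonsingular g" if "f \<in> Sp1 g" "x \<in> nonsingular g" for f x
    using that by (auto simp: Sp1_def Sp_def nonsingular_def)
  note units = admissible_unit[OF g]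
  have adm: "set as \<subseteq> nonsingular g" if "set as \<subseteq> admissible g" for as
    using that admissible_nonsingular[OF g] by blast
  obtain as where as: "set as \<subseteq> admissible g" "foldr (transvection g) as (f *\<^sub>v e g 0) = e g 0"
    using nonsingular_to_e0[OF g ns[OF assms(2)], of "e g 0"] units by auto
  let ?f1 = "foldr (\<lambda>a M. transvection_mat g a * M) as f"
  have f1: "?f1 \<in> Sp1 g" and f1_e0: "?f1 *\<^sub>v e g 0 = e g 0"
    using foldr_transvection_mat[OF g adm[OF as(1)] assms(2)] as(2) by simp_all
  have "sympl_form g (e g 0) (?f1 *\<^sub>v e g 1) = sympl_form g (?f1 *\<^sub>v e g 0) (?f1 *\<^sub>v e g 1)"
    by (simp only: f1_e0)
  also have "\<dots> = 1"
    using f1 g by (auto simp: Sp1_def Sp_def sympl_form_unit_vec)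
  finally obtain bs where bs: "set bs \<subseteq> admissible g" "foldr (transvection g) bs (e g 0) = e g 0"
     "foldr (transvection g) bs (?f1 *\<^sub>v e g 1) = e g 1"
    using nonsingular_to_e1_fixing_e0[OF g ns[OF f1], of "e g 1"] units by auto
  let ?f2 = "foldr (\<lambda>a M. transvection_mat g a * M) bs ?f1"
  note f2 = foldr_transvection_mat[OF g adm[OF bs(1)] f1]
  have "?f2 \<in> Sp_block g"
    using f2 bs f1_e0 by (intro fixes_plane_imp_Sp_block[OF g]) simp_all
  moreover have "1\<^sub>m ?n \<in> generated g" unfolding generated_def by (intro CollectI exI[of _ "[]"]) simp
  ultimately have "?f2 * 1\<^sub>m ?n \<in> generated g" by (intro generated_mult) auto
  moreover have "?f2 \<in> carrier_mat ?n ?n" using f2(1) by (simp add: Sp1_def Sp_def)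
  ultimately have "?f2 \<in> generated g" by simp
  then have "?f1 \<in> generated g" using generated_of_foldr_transvection[OF g bs(1) f1] by blast
  then have "f \<in> generated g" using generated_of_foldr_transvection[OF g as(1) assms(2)] by blast
  then show ?thesis by (auto simp: generated_def)
qed

end
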